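(* Let $\alpha,\beta,\gamma>0$ be real, let $t\ge0$, and let $X\sim\mathrm{ML}(\alpha,\beta,\gamma)$ (with parameter $t$). Then for all real $s\ge0$, $$\mathbb E X^s=\frac{\gamma\,t^\alpha}{E_{\alpha,\beta}^{\gamma}(t^\alpha)\,\Gamma(\alpha+\beta)}\;\Phi^{(1,\alpha)}_{\gamma+1;\,\alpha+\beta}(t^\alpha,1-s,1).$$
   Context: $\mathbb N_0=\{0,1,2,\dots\}$, and $(\lambda)_\mu=\Gamma(\lambda+\mu)/\Gamma(\lambda)$ for $\lambda>0$, $\mu\ge0$ (with $(\lambda)_0=1$). The Prabhakar (three-parameter Mittag-Leffler) function is $$E_{\alpha,\beta}^{\gamma}(z)=\sum_{k\ge 0}\frac{(\gamma)_k}{\Gamma(\alpha k+\beta)}\frac{z^k}{k!},\qquad \alpha,\beta,\gamma>0,\ z\in\mathbb C.$$ For $\alpha,\beta,\gamma>0$ and $t\ge0$, $X\sim\mathrm{ML}(\alpha,\beta,\gamma)$ means that $X$ is an $\mathbb N_0$-valued random variable with $$\mathbb P(X=k)=\frac{1}{E_{\alpha,\beta}^{\gamma}(t^\alpha)}\,\frac{(\gamma)_k\,t^{\alpha k}}{k!\,\Gamma(\alpha k+\beta)},\qquad k\in\mathbb N_0,$$ where $t^{\alpha k}$ is read as $1$ when $k=0$. The generalized Hurwitz-Lerch Zeta function is $$\Phi^{(\rho,\kappa)}_{\lambda;\,\nu}(z,s,a)=\sum_{n\ge0}\frac{(\lambda)_{\rho n}}{n!\,(\nu)_{\kappa n}}\,\frac{z^n}{(n+a)^s},$$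 where $\lambda,\nu,a,\rho,\kappa>0$, $\kappa-\rho+1>0$, $z\in\mathbb C$, $s\in\mathbb C$ (the series then converges for all $z$).
   Formalization: At s=0 the power X^0 is read with 0^0=0, so E X^0 means P(X>0); with 0^0=1 the printed formula fails at s=0 (for t=0, X=0 almost surely, the left side is 1 and the right side is 0). *)

theory Defs
  imports "HOL-Probability.Probability"
begin

(* The library's pochhammer only takes natural number indices. *)
definition gen_pochhammer :: "real \<Rightarrow> real \<Rightarrow> real" where
  "gen_pochhammer l \<mu> = Gamma (l + \<mu>) / Gamma l"

definition prabhakar :: "real \<Rightarrow> real \<Rightarrow> real \<Rightarrow> complex \<Rightarrow> complex" where
  "prabhakar \<alpha> \<beta> \<gamma> z =
     (\<Sum>k. of_real (gen_pochhammer \<gamma> (real k) / Gamma (\<alpha> * real k + \<beta>)) * (z ^ k / fact k))"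

(* hurwitz_lerch \<rho> \<kappa> l \<nu> z s a is \<Phi> with upper index (\<rho>, \<kappa>) and lower index l; \<nu>.
   The base of powr is a positive real, so its principal branch is the usual power. *)
definition hurwitz_lerch ::
    "real \<Rightarrow> real \<Rightarrow> real \<Rightarrow> real \<Rightarrow> complex \<Rightarrow> complex \<Rightarrow> real \<Rightarrow> complex" where
  "hurwitz_lerch \<rho> \<kappa> l \<nu> z s a =
     (\<Sum>n. of_real (gen_pochhammer l (\<rho> * real n) / (fact n * gen_pochhammer \<nu> (\<kappa> * real n)))
           * (z ^ n / of_real (real n + a) powr s))"

(* The case distinction is needed because 0 powr 0 = 0.  The equation is stated in the complex
   numbers because prabhakar is complex-valued. *)
definition mittag_leffler_distributed ::
    "'a measure \<Rightarrow> real \<Rightarrow> real \<Rightarrow> real \<Rightarrow> real \<Rightarrow> ('a \<Rightarrow> nat) \<Rightarrow> bool" where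
  "mittag_leffler_distributed M \<alpha> \<beta> \<gamma> t X \<longleftrightarrow>
     X \<in> measurable M (count_space UNIV) \<and>
     (\<forall>k. complex_of_real (measure M {\<omega> \<in> space M. X \<omega> = k}) =
        1 / prabhakar \<alpha> \<beta> \<gamma> (of_real (t powr \<alpha>)) *
        of_real (gen_pochhammer \<gamma> (real k) * (if k = 0 then 1 else t powr (\<alpha> * real k))
                 / (fact k * Gamma (\<alpha> * real k + \<beta>))))"

(* Moments of such an X are taken of real (X \<omega>) powr s.  For s = 0 this uses 0 powr 0 = 0, so the
   moment of order 0 is the probability of X > 0; this is the convention under which the moment
   formula in terms of hurwitz_lerch extends to s = 0. *)

end

theory Submission imports Defs "HOL-Real_Asymp.Real_Asymp" begin

text \<open>
  The moment of order \<open>s\<close> of a random variable with values in the natural numbers is the series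
  \<open>\<Sum>k. k powr s * P(X = k)\<close>.  Its term at \<open>0\<close> vanishes, so the index can be shifted by one.
  With \<open>x = t powr \<alpha>\<close>, the identities \<open>(\<gamma>)\<^bsub>n+1\<^esub> = \<gamma> (\<gamma>+1)\<^bsub>n\<^esub>\<close>, \<open>(n+1)! = (n+1) n!\<close> and
  \<open>\<Gamma>(\<alpha>(n+1)+\<beta>) = \<Gamma>(\<alpha>+\<beta>) (\<alpha>+\<beta>)\<^bsub>\<alpha>n\<^esub>\<close> turn the shifted term into a constant times the \<open>n\<close>-th term
  of the Hurwitz-Lerch series; the factor \<open>(n+1)\<close> from the factorial is what lowers the exponent
  \<open>s\<close> to \<open>s - 1\<close> (\<open>moment_term_eq_hurwitz_lerch_term\<close>).

  The analytic content is the absolute convergence of that series, which gives both the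
  integrability and the exchange of sum and expectation.  It follows from the ratio test, because
  \<open>\<Gamma>(y) / \<Gamma>(y + a)\<close> tends to \<open>0\<close> as \<open>y\<close> grows for every fixed \<open>a > 0\<close>; this in turn is a
  consequence of the logarithmic convexity of the Gamma function (\<open>Gamma_ratio_le\<close>).

  The normalising constant \<open>E\<close> is a common factor of all terms and is carried along unevaluated.  The
  computation takes place in the complex numbers because \<open>E\<close> is a complex number by definition.
\<close>

section \<open>Growth of the Gamma function\<close>

lemma Gamma_plus1_pos: "x > 0 \<Longrightarrow> Gamma (x + 1) = x * Gamma x" for x :: real
  by (rule Gamma_plus1) (auto elim!: nonpos_Ints_cases)

text \<open>
  By convexity, the slope of \<open>ln \<Gamma>\<close> on \<open>[y, y + a]\<close> is at least its slope on \<open>[y - 1, y]\<close>, and the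
  latter is \<open>ln (y - 1)\<close> by the functional equation.
\<close>

lemma Gamma_ratio_le:
  fixes y a :: real
  assumes "y > 1" "a > 0"
  shows "Gamma y / Gamma (y + a) \<le> (y - 1) powr (-a)"
proof -
  define f where "f = (ln \<circ> Gamma :: real \<Rightarrow> real)"
  have "convex_on {0<..} f"
    unfolding f_def by (rule log_convex_Gamma_real)
  from convex_on_slope_le[OF this, of "y - 1" "y + a" y] assms
  have "(f (y - 1) - f y) / (y - 1 - y) \<le> (f y - f (y + a)) / (y - (y + a))"
    by auto
  hence slopes: "a * (f y - f (y - 1)) \<le> f (y + a) - f y"
    using assms by (simp add: field_simps)
  have "Gamma y = (y - 1) * Gamma (y - 1)"
    using Gamma_plus1_pos[of "y - 1"] assms by simp
  moreover have "y - 1 > 0" "Gamma (y - 1) > 0"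
    using assms by (auto intro: Gamma_real_pos)
  ultimately have "f y = ln (y - 1) + f (y - 1)"
    unfolding f_def o_def by (simp only: ln_mult_pos)
  with slopes have "f y - f (y + a) \<le> - a * ln (y - 1)"
    by (simp add: algebra_simps)
  hence "exp (f y - f (y + a)) \<le> exp (- a * ln (y - 1))"
    by simp
  thus ?thesis
    using assms by (simp add: f_def exp_diff powr_def Gamma_real_pos)
qed

lemma Gamma_ratio_tendsto_0:
  fixes a :: real
  assumes "a > 0"
  shows "((\<lambda>y. Gamma y / Gamma (y + a)) \<longlongrightarrow> 0) at_top"
proof (rule tendsto_sandwich)
  show "eventually (\<lambda>y. 0 \<le> Gamma y / Gamma (y + a)) at_top"
    using eventually_gt_at_top[of "1 :: real"]
    by eventually_elim (use assms in \<open>simp add: Gamma_real_pos less_imp_le\<close>)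
  show "eventually (\<lambda>y. Gamma y / Gamma (y + a) \<le> (y - 1) powr (-a)) at_top"
    using eventually_gt_at_top[of "1 :: real"]
    by eventually_elim (use assms Gamma_ratio_le in simp)
  show "((\<lambda>y::real. (y - 1) powr (-a)) \<longlongrightarrow> 0) at_top"
    using assms by real_asymp
qed simp

section \<open>Convergence of the Hurwitz-Lerch series\<close>

text \<open>
  Stating the quotient of consecutive terms multiplicatively keeps the ratio test applicable when
  terms vanish, as they do for a power series at the origin.
\<close>

lemma summable_if_ratio_tendsto_0:
  fixes f r :: "nat \<Rightarrow> real"
  assumes step: "\<And>n. f (Suc n) = r n * f n" and "r \<longlonglongrightarrow> 0"
  shows "summable f"
proof -
  have "eventually (\<lambda>n. norm (r n) < 1/2) sequentially"
    using order_tendstoD(2)[OF tendsto_norm_zero[OF assms(2)], of "1/2"] by simp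
  then obtain N where N: "\<And>n. n \<ge> N \<Longrightarrow> norm (r n) < 1/2"
    by (auto simp: eventually_sequentially)
  show ?thesis
  proof (rule summable_ratio_test[of "1/2" N])
    fix n assume "n \<ge> N"
    show "norm (f (Suc n)) \<le> 1/2 * norm (f n)"
      unfolding step norm_mult using N[OF \<open>n \<ge> N\<close>] by (intro mult_right_mono) auto
  qed simp
qed

lemma summable_gen_pochhammer_series:
  fixes l \<nu> \<kappa> x p :: real
  assumes "l > 0" "\<nu> > 0" "\<kappa> > 0"
  shows "summable (\<lambda>n. gen_pochhammer l (real n) / (fact n * gen_pochhammer \<nu> (\<kappa> * real n))
           * (x ^ n * (real n + 1) powr p))"
proof (rule summable_if_ratio_tendsto_0)
  define G where "G = (\<lambda>n. Gamma (\<nu> + \<kappa> * real n) / Gamma (\<nu> + \<kappa> * real n + \<kappa>))"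
  define r where
    "r = (\<lambda>n. x * ((l + real n) / (real n + 1)) * ((real n + 2) / (real n + 1)) powr p * G n)"
  have "filterlim (\<lambda>n. \<nu> + \<kappa> * real n) at_top sequentially"
    using \<open>\<kappa> > 0\<close> by real_asymp
  from filterlim_compose[OF Gamma_ratio_tendsto_0[OF \<open>\<kappa> > 0\<close>] this]
  have G: "G \<longlonglongrightarrow> 0"
    by (simp add: G_def)
  have "(\<lambda>n. (l + real n) / (real n + 1)) \<longlonglongrightarrow> 1"
    "(\<lambda>n. ((real n + 2) / (real n + 1)) powr p) \<longlonglongrightarrow> 1"
    by real_asymp+
  from tendsto_mult[OF tendsto_mult[OF tendsto_mult[OF tendsto_const[of x] this(1)] this(2)] G]
  show "r \<longlonglongrightarrow> 0"
    by (simp add: r_def)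
  fix n
  have l: "Gamma (l + real (Suc n)) = (l + real n) * Gamma (l + real n)"
    using Gamma_plus1_pos[of "l + real n"] assms(1) by (simp add: add_ac)
  have "\<nu> + \<kappa> * real n > 0"
    using assms by (simp add: add_pos_nonneg)
  hence pos: "Gamma (\<nu> + \<kappa> * real n) > 0" "Gamma (\<nu> + \<kappa> * real n + \<kappa>) > 0"
    using assms by (auto intro!: Gamma_real_pos)
  have \<nu>: "\<nu> + \<kappa> * real (Suc n) = \<nu> + \<kappa> * real n + \<kappa>"
    by (simp add: algebra_simps)
  have powr: "(real (Suc n) + 1) powr p
      = ((real n + 2) / (real n + 1)) powr p * (real n + 1) powr p"
    by (simp add: powr_mult[symmetric] add_ac)
  \<comment> \<open>Left as a sum, \<open>real n + 1\<close> would be multiplied out and never cancelled.\<close>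
  define u where "u = real n + 1"
  hence "u > 0" "real (Suc n) = u"
    by simp_all
  show "gen_pochhammer l (real (Suc n)) / (fact (Suc n) * gen_pochhammer \<nu> (\<kappa> * real (Suc n)))
          * (x ^ Suc n * (real (Suc n) + 1) powr p) =
        r n * (gen_pochhammer l (real n) / (fact n * gen_pochhammer \<nu> (\<kappa> * real n))
          * (x ^ n * (real n + 1) powr p))"
    unfolding gen_pochhammer_def r_def G_def l \<nu> powr fact_Suc
    unfolding u_def[symmetric] \<open>real (Suc n) = u\<close>
    using pos \<open>u > 0\<close> by (simp add: divide_simps)
qed

section \<open>Expectations of functions of a random variable with natural values\<close>

text \<open>
  Writing \<open>f \<circ> X\<close> as the series of its restrictions to the level sets of \<open>X\<close> reduces the claim to
  termwise integration.
\<close>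

lemma (in finite_measure) expectation_nat_valued:
  fixes f :: "nat \<Rightarrow> real"
  assumes [measurable]: "X \<in> measurable M (count_space UNIV)"
    and "summable (\<lambda>k. \<bar>f k\<bar> * measure M {\<omega> \<in> space M. X \<omega> = k})"
  shows "integrable M (\<lambda>\<omega>. f (X \<omega>))"
    and "(\<lambda>k. f k * measure M {\<omega> \<in> space M. X \<omega> = k}) sums (\<integral>\<omega>. f (X \<omega>) \<partial>M)"
proof -
  define A where "A k = {\<omega> \<in> space M. X \<omega> = k}" for k
  have A [measurable]: "A k \<in> sets M" for k
    unfolding A_def by measurable
  define g where "g k \<omega> = f k * indicator (A k) \<omega>" for k \<omega>
  have g_int: "integrable M (g k)" for k
    unfolding g_def by (intro integrable_mult_right) (simp add: emeasure_eq_measure)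
  have int_g: "(\<integral>\<omega>. g k \<omega> \<partial>M) = f k * measure M (A k)"
    and int_norm_g: "(\<integral>\<omega>. norm (g k \<omega>) \<partial>M) = \<bar>f k\<bar> * measure M (A k)" for k
    by (simp_all add: g_def abs_mult)
  have zero: "g k \<omega> = 0" if "k \<noteq> X \<omega>" for k \<omega>
    using that by (auto simp: g_def A_def)
  have summable: "summable (\<lambda>k. norm (g k \<omega>))" for \<omega>
    by (rule summable_finite[of "{X \<omega>}"]) (use zero in auto)
  have suminf: "(\<Sum>k. g k \<omega>) = f (X \<omega>)" if "\<omega> \<in> space M" for \<omega>
  proof -
    have "(\<Sum>k. g k \<omega>) = (\<Sum>k\<in>{X \<omega>}. g k \<omega>)"
      by (rule suminf_finite) (use zero in auto)
    thus ?thesis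
      using that by (simp add: g_def A_def)
  qed
  have "summable (\<lambda>k. \<integral>\<omega>. norm (g k \<omega>) \<partial>M)"
    unfolding int_norm_g A_def by (rule assms(2))
  note series = g_int AE_I2[OF summable] this
  show "integrable M (\<lambda>\<omega>. f (X \<omega>))"
    using integrable_suminf[OF series] suminf by (simp cong: Bochner_Integration.integrable_cong)
  show "(\<lambda>k. f k * measure M {\<omega> \<in> space M. X \<omega> = k}) sums (\<integral>\<omega>. f (X \<omega>) \<partial>M)"
    using sums_integral[OF series] suminf
    by (simp add: int_g A_def cong: Bochner_Integration.integral_cong)
qed

section \<open>The moments\<close>

text \<open>
  Reducing \<open>n + 1\<close> from \<open>(n+1)!\<close> against one power of \<open>(n+1) powr s\<close> leaves \<open>n!\<close> and the exponent
  \<open>s - 1\<close>.  Since \<open>n + 1 > 0\<close>, rewriting \<open>t powr (\<alpha> * (n+1))\<close> as a power of \<open>t powr \<alpha>\<close> is valid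
  for \<open>t = 0\<close> as well, where both sides are \<open>0\<close>.
\<close>

lemma moment_term_eq_hurwitz_lerch_term:
  fixes \<alpha> \<beta> \<gamma> t s :: real
  assumes "\<alpha> > 0" "\<beta> > 0" "\<gamma> > 0" "t \<ge> 0"
  shows "real (Suc n) powr s *
      (gen_pochhammer \<gamma> (real (Suc n)) * t powr (\<alpha> * real (Suc n))
        / (fact (Suc n) * Gamma (\<alpha> * real (Suc n) + \<beta>))) =
    \<gamma> * t powr \<alpha> / Gamma (\<alpha> + \<beta>) *
      (gen_pochhammer (\<gamma> + 1) (real n) / (fact n * gen_pochhammer (\<alpha> + \<beta>) (\<alpha> * real n))
        * ((t powr \<alpha>) ^ n * (real n + 1) powr (s - 1)))"
proof -
  have \<gamma>: "Gamma (\<gamma> + 1) = \<gamma> * Gamma \<gamma>"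
    using assms by (intro Gamma_plus1_pos)
  have pos: "Gamma \<gamma> > 0" "Gamma (\<alpha> + \<beta>) > 0"
    using assms by (auto intro!: Gamma_real_pos)
  have "t powr (\<alpha> * real (Suc n)) = (t powr \<alpha>) ^ Suc n"
    using assms by (cases "t = 0") (simp_all add: powr_powr[symmetric] powr_realpow del: of_nat_Suc)
  moreover have "real (Suc n) powr s = (real n + 1) * (real n + 1) powr (s - 1)"
    by (simp add: powr_mult_base add_ac)
  moreover have args: "\<gamma> + real (Suc n) = \<gamma> + 1 + real n"
    "\<alpha> * real (Suc n) + \<beta> = \<alpha> + \<beta> + \<alpha> * real n"
    by (simp_all add: algebra_simps)
  \<comment> \<open>An opaque name for \<open>real n + 1\<close>, so that it cancels as a single factor.\<close>
  moreover define u where "u = real n + 1"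
  hence "u > 0" "real (Suc n) = u"
    by simp_all
  ultimately show ?thesis
    unfolding gen_pochhammer_def args \<gamma> fact_Suc u_def[symmetric] using pos assms(3)
    by (simp add: divide_simps)
qed

lemma hurwitz_lerch_eq_suminf_real:
  fixes l \<nu> \<kappa> x s :: real
  assumes "l > 0" "\<nu> > 0" "\<kappa> > 0"
  shows "hurwitz_lerch 1 \<kappa> l \<nu> (of_real x) (1 - of_real s) 1 =
    of_real (\<Sum>n. gen_pochhammer l (real n) / (fact n * gen_pochhammer \<nu> (\<kappa> * real n))
      * (x ^ n * (real n + 1) powr (s - 1)))"
proof -
  have "1 / complex_of_real (real n + 1) powr (1 - of_real s)
      = of_real ((real n + 1) powr (s - 1))" for n
  proof -
    have "complex_of_real (real n + 1) powr of_real (1 - s) = of_real ((real n + 1) powr (1 - s))"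
      by (rule powr_of_real) simp_all
    moreover have "(real n + 1) powr (s - 1) = 1 / (real n + 1) powr (1 - s)"
      using powr_minus_divide[of "real n + 1" "1 - s"] by simp
    ultimately show ?thesis
      by simp
  qed
  hence "complex_of_real x ^ n / of_real (real n + 1) powr (1 - of_real s)
      = of_real (x ^ n * (real n + 1) powr (s - 1))" for n
    by (simp add: divide_inverse)
  thus ?thesis
    unfolding hurwitz_lerch_def suminf_of_real[OF summable_gen_pochhammer_series[OF assms]]
    by simp
qed

theorem theorem2:
  fixes \<alpha> \<beta> \<gamma> t s :: real and M :: "'a measure" and X :: "'a \<Rightarrow> nat"
  assumes "\<alpha> > 0" and "\<beta> > 0" and "\<gamma> > 0" and "t \<ge> 0"
    and "prob_space M"
    and "mittag_leffler_distributed M \<alpha> \<beta> \<gamma> t X"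
    and "s \<ge> 0"
  shows "integrable M (\<lambda>\<omega>. real (X \<omega>) powr s) \<and>
    complex_of_real (\<integral>\<omega>. real (X \<omega>) powr s \<partial>M) =
      of_real (\<gamma> * t powr \<alpha>)
        / (prabhakar \<alpha> \<beta> \<gamma> (of_real (t powr \<alpha>)) * of_real (Gamma (\<alpha> + \<beta>)))
      * hurwitz_lerch 1 \<alpha> (\<gamma> + 1) (\<alpha> + \<beta>) (of_real (t powr \<alpha>)) (1 - of_real s) 1"
proof -
  interpret prob_space M
    by fact
  define E where "E = prabhakar \<alpha> \<beta> \<gamma> (of_real (t powr \<alpha>))"
  define C where "C = \<gamma> * t powr \<alpha> / Gamma (\<alpha> + \<beta>)"
  define h where "h n = gen_pochhammer (\<gamma> + 1) (real n)
      / (fact n * gen_pochhammer (\<alpha> + \<beta>) (\<alpha> * real n))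
      * ((t powr \<alpha>) ^ n * (real n + 1) powr (s - 1))" for n
  define m where "m k = real k powr s * measure M {\<omega> \<in> space M. X \<omega> = k}" for k
  have X: "X \<in> measurable M (count_space UNIV)"
    using assms(6) by (simp add: mittag_leffler_distributed_def)
  have h: "summable h"
    unfolding h_def using assms by (intro summable_gen_pochhammer_series) auto
  have m: "complex_of_real (m (Suc n)) = of_real (C * h n) / E" for n
  proof -
    have "complex_of_real (measure M {\<omega> \<in> space M. X \<omega> = Suc n}) = 1 / E *
        of_real (gen_pochhammer \<gamma> (real (Suc n)) * t powr (\<alpha> * real (Suc n))
          / (fact (Suc n) * Gamma (\<alpha> * real (Suc n) + \<beta>)))"
      using assms(6)[unfolded mittag_leffler_distributed_def, THEN conjunct2, rule_format, of "Suc n"]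
      unfolding E_def by (simp only: nat.distinct if_False)
    hence "complex_of_real (m (Suc n)) = of_real (real (Suc n) powr s *
        (gen_pochhammer \<gamma> (real (Suc n)) * t powr (\<alpha> * real (Suc n))
          / (fact (Suc n) * Gamma (\<alpha> * real (Suc n) + \<beta>)))) / E"
      unfolding m_def of_real_mult by (simp only: times_divide_eq_left times_divide_eq_right mult_1_left)
    thus ?thesis
      unfolding moment_term_eq_hurwitz_lerch_term[OF assms(1-4)] C_def h_def .
  qed
  have "summable (\<lambda>n. complex_of_real (m (Suc n)))"
    unfolding m using h by (intro summable_divide summable_of_real summable_mult)
  hence "summable m"
    by (simp only: summable_of_real_iff summable_Suc_iff)
  hence "summable (\<lambda>k. \<bar>real k powr s\<bar> * measure M {\<omega> \<in> space M. X \<omega> = k})"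
    by (simp add: m_def[abs_def])
  note expectation = expectation_nat_valued[OF X this]
  have "m sums (\<integral>\<omega>. real (X \<omega>) powr s \<partial>M)"
    using expectation(2) by (simp add: m_def[abs_def])
  \<comment> \<open>This covers \<open>s = 0\<close> too, because \<open>0 powr 0 = 0\<close>.\<close>
  moreover have "m 0 = 0"
    by (simp add: m_def)
  ultimately have "(\<lambda>n. m (Suc n)) sums (\<integral>\<omega>. real (X \<omega>) powr s \<partial>M)"
    by (simp add: sums_Suc_iff)
  hence "(\<lambda>n. complex_of_real (m (Suc n))) sums of_real (\<integral>\<omega>. real (X \<omega>) powr s \<partial>M)"
    by (rule sums_of_real)
  moreover have "(\<lambda>n. complex_of_real (m (Suc n))) sums (of_real (C * suminf h) / E)"
    unfolding m using h by (intro sums_divide sums_of_real sums_mult summable_sums)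
  ultimately have "complex_of_real (\<integral>\<omega>. real (X \<omega>) powr s \<partial>M) = of_real (C * suminf h) / E"
    by (rule sums_unique2)
  also have "\<dots> = of_real (\<gamma> * t powr \<alpha>) / (E * of_real (Gamma (\<alpha> + \<beta>))) * of_real (suminf h)"
    by (simp add: C_def)
  also have "complex_of_real (suminf h)
      = hurwitz_lerch 1 \<alpha> (\<gamma> + 1) (\<alpha> + \<beta>) (of_real (t powr \<alpha>)) (1 - of_real s) 1"
    using assms by (subst hurwitz_lerch_eq_suminf_real) (auto simp: h_def[abs_def])
  finally show ?thesis
    using expectation(1) unfolding E_def by blast
qed

end
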